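(* Let $\delta\in(0,2]$ be real and let $P\subset\mathbb{R}^2$ be a set of $n$ points with $\dim_{\mathsf f}(P)=\delta$. Let $S$ be the set of line segments of a rectilinear Steiner minimal tree of $P$. Then there exists a circle $C$ such that at least $1/8$ of the points of $P$ lie in the interior of $C$, at least $1/8$ of the points of $P$ lie outside $C$, and $S_C=\{s\in S: s\cap C\neq\emptyset\}$ satisfies $|S_C|=O(n^{1-1/\delta})$ if $\delta>1$, $|S_C|=O(\log n)$ if $\delta=1$, and $|S_C|=O\!\left(\frac{1}{2^{1-\delta}-1}\right)$ if $\delta<1$.
   Context: A rectilinear Steiner minimal tree of $P$ is a minimum-total-length connected geometric graph containing $P$ whose edges are axis-parallel segments (extra Steiner vertices allowed). Fractal dimension: for a family of finite pointsets $P\subseteq\mathbb{R}^d$ (with $|P|$ unbounded), $\dim_{\mathsf f}(P)$ is the infimum of $\delta$ such that there is a constant $c$ with: for every member $P$, every $\varepsilon>0$, every $r\ge2\varepsilon$, every $\varepsilon$-net $N$ of $P$ (a subset of $P$ whose points are pairwise at distance $\ge\varepsilon$ and such that every point of $P$ is within distance $\varepsilon$ of $N$) and every $x$, $|N\cap\mathrm{ball}(x,r)|\le c(r/\varepsilon)^\delta$, with $\mathrm{ball}$ the closed Euclidean ball. Asymptotics as $n\to\infty$; constants may depend on $\delta$, $c$.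
   Formalization: The infimum defining the fractal dimension is assumed to be attained: the packing bound c(r/ε)^δ holds at the exponent δ itself with some constant c, on which the O-constants depend; with a non-attained infimum the stated bounds can fail. *)

theory Defs
  imports "HOL-Analysis.Analysis"
begin

definition eps_net :: "(real^2) set \<Rightarrow> real \<Rightarrow> (real^2) set \<Rightarrow> bool" where
  "eps_net P eps N \<longleftrightarrow> N \<subseteq> P \<and> (\<forall>p\<in>N. \<forall>q\<in>N. p \<noteq> q \<longrightarrow> dist p q \<ge> eps)
     \<and> (\<forall>p\<in>P. \<exists>q\<in>N. dist p q \<le> eps)"

definition net_bound :: "real \<Rightarrow> real \<Rightarrow> (real^2) set \<Rightarrow> bool" where
  "net_bound d c P \<longleftrightarrow> (\<forall>eps r N x. eps > 0 \<and> r \<ge> 2 * eps \<and> eps_net P eps N \<longrightarrow>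
      real (card (N \<inter> cball x r)) \<le> c * (r / eps) powr d)"

definition fractal_dim :: "(real^2) set set \<Rightarrow> real" where
  "fractal_dim F = Inf {d. \<exists>c. \<forall>P\<in>F. net_bound d c P}"

definition rect_seg :: "(real^2) set \<Rightarrow> bool" where
  "rect_seg s \<longleftrightarrow> (\<exists>a b. a \<noteq> b \<and> (a$1 = b$1 \<or> a$2 = b$2) \<and> s = closed_segment a b)"

definition rect_network :: "(real^2) set \<Rightarrow> (real^2) set set \<Rightarrow> bool" where
  "rect_network P S \<longleftrightarrow> finite S \<and> (\<forall>s\<in>S. rect_seg s) \<and> P \<subseteq> \<Union>S \<and> connected (\<Union>S)"

definition network_length :: "(real^2) set set \<Rightarrow> real" where
  "network_length S = (\<Sum>s\<in>S. diameter s)"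

definition rsmt :: "(real^2) set \<Rightarrow> (real^2) set set \<Rightarrow> bool" where
  "rsmt P S \<longleftrightarrow> rect_network P S \<and>
     (\<forall>S'. rect_network P S' \<longrightarrow> network_length S \<le> network_length S')"

definition sep_bound :: "real \<Rightarrow> nat \<Rightarrow> real" where
  "sep_bound \<delta> n = (if \<delta> > 1 then real n powr (1 - 1 / \<delta>)
                     else if \<delta> = 1 then ln (real n)
                     else 1 / (2 powr (1 - \<delta>) - 1))"

end

theory Submission
  imports Defs
begin

text \<open>Let \<open>R\<^sub>0\<close> be the infimal radius of a disc containing an eighth of the points. Every circle
  around a nearly optimal centre with radius in \<open>(3/2 R\<^sub>0, 2 R\<^sub>0)\<close> is balanced, because a disc of
  radius less than \<open>2 R\<^sub>0\<close> is covered by seven discs of radius less than \<open>R\<^sub>0\<close>. Averaging over these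
  radii, some circle meets at most \<open>2 L / R\<^sub>0\<close> segments, where \<open>L\<close> is the length of the tree inside
  the square circumscribed about the disc of radius \<open>h = 2 R\<^sub>0\<close>. By minimality, \<open>L\<close> is at most the
  length of any network inside the square that contains its boundary and the points in it. Joining nets
  at the scales \<open>h / 2^i\<close>, \<open>i \<le> k\<close>, successively and then all points to the last net gives
  such a network of length \<open>O(h (\<Sum>i\<le>k. 2^(i (\<delta> - 1)) + n / 2^k))\<close>, and \<open>2^k \<approx> n^(1/\<delta>)\<close>
  yields the bound.\<close>

lemma dist_real2: "dist p q = sqrt ((p$1 - q$1)\<^sup>2 + (p$2 - q$2)\<^sup>2)" for p q :: "real^2"
  by (simp add: dist_vec_def L2_set_def sum_2 dist_real_def)

subsection \<open>Nets\<close>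

text \<open>A maximal \<open>e\<close>-separated set \<open>N\<close> with
  \<open>M \<subseteq> N \<subseteq> P\<close> is a net: a point farther than \<open>e\<close> from
  all of \<open>N\<close> could still be added. Taking \<open>M\<close> empty gives existence of
  nets.\<close>

lemma eps_net_extend:
  assumes "finite P" "M \<subseteq> P" "\<And>p q. p \<in> M \<Longrightarrow> q \<in> M \<Longrightarrow> p \<noteq> q \<Longrightarrow> e \<le> dist p q" "0 < e"
  obtains N where "M \<subseteq> N" "eps_net P e N"
proof -
  define Q where "Q = {N. M \<subseteq> N \<and> N \<subseteq> P \<and> (\<forall>p\<in>N. \<forall>q\<in>N. p \<noteq> q \<longrightarrow> e \<le> dist p q)}"
  have fin: "finite Q"
    by (rule finite_subset[of _ "Pow P"]) (use assms(1) in \<open>auto simp: Q_def\<close>)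
  have "M \<in> Q"
    using assms by (auto simp: Q_def)
  then obtain N where N: "N \<in> Q" and mx: "\<And>N'. N' \<in> Q \<Longrightarrow> N \<subseteq> N' \<Longrightarrow> N' = N"
    using finite_has_maximal2[OF fin] by metis
  have "\<exists>q\<in>N. dist p q \<le> e" if p: "p \<in> P" for p
  proof (rule ccontr)
    assume "\<not> ?thesis"
    then have far: "\<And>q. q \<in> N \<Longrightarrow> e < dist p q"
      by force
    then have "insert p N \<in> Q"
      using N p by (auto simp: Q_def dist_commute less_imp_le)
    then have "p \<in> N"
      using mx by blast
    then show False
      using far[of p] assms(4) by simp
  qed
  then have "eps_net P e N"
    using N by (auto simp: eps_net_def Q_def)
  then show thesis
    using that N by (auto simp: Q_def)
qed

text \<open>\<open>net_bound\<close> speaks of nets of all of \<open>P\<close>, whereas nets of the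
  part of \<open>P\<close> in a square have to be counted. A net of \<open>A\<close> is separated,
  so it extends to a net of \<open>P\<close>, and it lies in the disc around
  \<open>A\<close>.\<close>

lemma net_bound_subset:
  assumes "finite P" "net_bound d c P" "A \<subseteq> P" "A \<subseteq> cball x r" "0 < e" "2 * e \<le> r"
  obtains M where "eps_net A e M" "real (card M) \<le> c * (r / e) powr d"
proof -
  have "finite A"
    using assms finite_subset by blast
  then obtain M where M: "eps_net A e M"
    using eps_net_extend[of A "{}" e] assms by auto
  then have MA: "M \<subseteq> A"
    by (simp add: eps_net_def)
  obtain N where N: "M \<subseteq> N" "eps_net P e N"
    using eps_net_extend[of P M e] assms M by (metis eps_net_def order_trans)
  have "finite N"
    using N assms(1) by (auto simp: eps_net_def intro: finite_subset)
  then have "card M \<le> card (N \<inter> cball x r)"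
    using N MA assms by (intro card_mono) auto
  also have "real (card (N \<inter> cball x r)) \<le> c * (r / e) powr d"
    using assms N unfolding net_bound_def by blast
  finally show thesis
    using that M by simp
qed

subsection \<open>Balanced circles\<close>

text \<open>The concentric disc covers the inner half of the radius. The annulus from
  \<open>r\<close> to \<open>2 * r\<close> is covered by six discs centred at distance
  \<open>sqrt 3 * r\<close>, in directions 60 degrees apart. The offsets \<open>D\<close> serve all
  discs by translation and scaling.\<close>

lemma disc_covered_by_seven:
  obtains D :: "(real^2) set" where "card D \<le> 7" "finite D"
    "\<And>(x::real^2) r. 0 \<le> r \<Longrightarrow> cball x (2 * r) \<subseteq> (\<Union>u\<in>D. cball (x + r *\<^sub>R u) r)"
proof -
  define v :: "real \<Rightarrow> real \<Rightarrow> real^2" where "v a b = vector [a, b]" for a b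
  define U where "U = [v (sqrt 3) 0, v (- sqrt 3) 0, v (sqrt 3/2) (3/2), v (sqrt 3/2) (-3/2),
                  v (-sqrt 3/2) (3/2), v (-sqrt 3/2) (-3/2)]"
  define D where "D = set (0 # U)"
  have "card D \<le> 7"
    unfolding D_def by (rule order_trans[OF card_length]) (simp add: U_def)
  have s3: "sqrt 3 * sqrt 3 = (3::real)" "sqrt 3 > 0"
    by auto
  \<comment> \<open>Every direction makes an angle of at most 30 degrees with one of the six outer centres.\<close>
  have dir: "\<exists>u\<in>set U. 3/2 * norm w \<le> w \<bullet> u" for w :: "real^2"
  proof -
    define a b where "a = w$1" and "b = w$2"
    have nw: "norm w = sqrt (a\<^sup>2 + b\<^sup>2)"
      by (simp add: norm_vec_def L2_set_def sum_2 a_def b_def)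
    \<comment> \<open>Directions within 30 degrees of the horizontal axis use a centre on that axis;
      \<open>far\<close> treats the others with the diagonal centre whose signs match
      \<open>a\<close> and \<open>b\<close>.\<close>
    have near: "3/2 * sqrt (a\<^sup>2 + b\<^sup>2) \<le> sqrt 3 * \<bar>a\<bar>" if "sqrt 3 * \<bar>b\<bar> \<le> \<bar>a\<bar>"
    proof -
      have "(sqrt 3 * \<bar>b\<bar>)\<^sup>2 \<le> \<bar>a\<bar>\<^sup>2"
        using that by (intro power_mono) auto
      then have "(3/2)\<^sup>2 * (a\<^sup>2 + b\<^sup>2) \<le> (sqrt 3 * \<bar>a\<bar>)\<^sup>2"
        by (simp add: power_mult_distrib power_divide)
      then have "sqrt ((3/2)\<^sup>2 * (a\<^sup>2 + b\<^sup>2)) \<le> sqrt 3 * \<bar>a\<bar>"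
        by (intro real_le_lsqrt) auto
      then show ?thesis
        by (simp add: real_sqrt_mult real_sqrt_divide)
    qed
    have far: "3/2 * sqrt (a\<^sup>2 + b\<^sup>2) \<le> sqrt 3/2 * \<bar>a\<bar> + 3/2 * \<bar>b\<bar>" if "\<bar>a\<bar> \<le> sqrt 3 * \<bar>b\<bar>"
    proof -
      have "\<bar>a\<bar> * \<bar>a\<bar> \<le> sqrt 3 * \<bar>b\<bar> * \<bar>a\<bar>"
        using that by (intro mult_right_mono) auto
      then have "(3/2)\<^sup>2 * (a\<^sup>2 + b\<^sup>2) \<le> (sqrt 3/2 * \<bar>a\<bar> + 3/2 * \<bar>b\<bar>)\<^sup>2"
        using s3 by (simp add: power2_eq_square algebra_simps)
      then have "sqrt ((3/2)\<^sup>2 * (a\<^sup>2 + b\<^sup>2)) \<le> sqrt 3/2 * \<bar>a\<bar> + 3/2 * \<bar>b\<bar>"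
        by (intro real_le_lsqrt) auto
      then show ?thesis
        by (simp add: real_sqrt_mult real_sqrt_divide)
    qed
    have ip: "w \<bullet> v p q = a * p + b * q" for p q
      by (simp add: inner_vec_def sum_2 a_def b_def v_def)
    show ?thesis
    proof (cases "sqrt 3 * \<bar>b\<bar> \<le> \<bar>a\<bar>")
      case True
      then show ?thesis
        using near[OF True] unfolding nw
        by (cases "a \<ge> 0") (auto simp: U_def ip mult.commute)
    next
      case False
      then show ?thesis
        using far unfolding nw
        by (cases "a \<ge> 0"; cases "b \<ge> 0") (auto simp: U_def ip mult.commute)
    qed
  qed
  have nU: "u \<bullet> u = 3" if "u \<in> set U" for u
    using that s3 by (auto simp: U_def v_def inner_vec_def sum_2)
  have "\<exists>u\<in>D. dist (x + r *\<^sub>R u) y \<le> r" if r: "0 \<le> r" and y: "dist x y \<le> 2 * r" for x y :: "real^2" and r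
  proof (cases "dist x y \<le> r")
    case True
    then show ?thesis by (auto simp: D_def)
  next
    case False
    define w where "w = y - x"
    have nw: "r < norm w" "norm w \<le> 2 * r"
      using False y by (auto simp: w_def dist_norm norm_minus_commute)
    obtain u where u: "u \<in> set U" "3/2 * norm w \<le> w \<bullet> u"
      using dir by blast
    have "(norm (w - r *\<^sub>R u))\<^sup>2 = (norm w)\<^sup>2 - 2 * r * (w \<bullet> u) + 3 * r\<^sup>2"
      unfolding power2_norm_eq_inner
      by (simp add: inner_diff_left inner_diff_right nU[OF u(1)] inner_commute power2_eq_square)
    also have "\<dots> \<le> (norm w)\<^sup>2 - 2 * r * (3/2 * norm w) + 3 * r\<^sup>2"
      using mult_left_mono[OF u(2) r] by simp
    \<comment> \<open>The subtracted product vanishes exactly at \<open>norm w = r\<close> and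
      \<open>norm w = 2 * r\<close>, the two ends of the annulus.\<close>
    also have "\<dots> = r\<^sup>2 - (norm w - r) * (2 * r - norm w)"
      by (simp add: power2_eq_square algebra_simps)
    also have "\<dots> \<le> r\<^sup>2"
      using nw by simp
    finally have "norm (w - r *\<^sub>R u) \<le> r"
      using r by (simp add: power2_le_iff_abs_le)
    moreover have "dist (x + r *\<^sub>R u) y = norm (w - r *\<^sub>R u)"
      by (simp add: w_def dist_norm norm_minus_commute algebra_simps)
    moreover have "u \<in> D"
      using u(1) by (simp add: D_def)
    ultimately show ?thesis
      by metis
  qed
  then have "\<And>(x::real^2) r. 0 \<le> r \<Longrightarrow> cball x (2 * r) \<subseteq> (\<Union>u\<in>D. cball (x + r *\<^sub>R u) r)"
    by (auto simp: mem_cball)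
  moreover have "finite D"
    by (simp add: D_def)
  ultimately show thesis
    using that \<open>card D \<le> 7\<close> by blast
qed

lemma finite_min_dist:
  assumes "finite (P :: 'a::metric_space set)"
  obtains d where "0 < d" "\<And>p q. p \<in> P \<Longrightarrow> q \<in> P \<Longrightarrow> p \<noteq> q \<Longrightarrow> d \<le> dist p q"
proof -
  \<comment> \<open>The element 1 keeps \<open>X\<close> nonempty when \<open>P\<close> has fewer
    than two points.\<close>
  define X where "X = insert 1 ((\<lambda>(p, q). dist p q) ` {(p, q) \<in> P \<times> P. p \<noteq> q})"
  have "finite {(p, q) \<in> P \<times> P. p \<noteq> q}"
    by (rule finite_subset[of _ "P \<times> P"]) (use assms in auto)
  then have fin: "finite X"
    by (simp add: X_def)
  have "Min X > 0"
    using fin by (subst Min_gr_iff) (auto simp: X_def)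
  moreover have "Min X \<le> dist p q" if "p \<in> P" "q \<in> P" "p \<noteq> q" for p q
    using that fin by (intro Min_le) (auto simp: X_def)
  ultimately show thesis
    using that by blast
qed

text \<open>The lower end \<open>3/2 * R0\<close> leaves room for a disc whose radius only
  approximates the infimum; the upper end \<open>2 * R0\<close> puts \<open>r / 2\<close> strictly
  below the infimum.\<close>

lemma balanced_circles:
  fixes P :: "(real^2) set"
  assumes fin: "finite P" and n: "8 < card P"
  obtains x R0 where "0 < R0"
    "\<And>r. 3/2 * R0 < r \<Longrightarrow> r < 2 * R0 \<Longrightarrow>
      real (card P) / 8 \<le> real (card (P \<inter> ball x r)) \<and> real (card P) / 8 \<le> real (card (P - cball x r))"
proof -
  define n where "n = real (card P)"
  define X where "X = {R. \<exists>x. n / 8 \<le> real (card (P \<inter> cball x R))}"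
  define R0 where "R0 = Inf X"
  obtain d where d: "0 < d" "\<And>p q. p \<in> P \<Longrightarrow> q \<in> P \<Longrightarrow> p \<noteq> q \<Longrightarrow> d \<le> dist p q"
    using finite_min_dist[OF fin] by blast
  \<comment> \<open>An eighth of more than eight points is more than one point, so such a disc
    contains two points at distance at least \<open>d\<close>. This keeps \<open>R0\<close>
    positive.\<close>
  have lower: "d / 2 \<le> R" if RX: "R \<in> X" for R
  proof -
    obtain x where "n / 8 \<le> real (card (P \<inter> cball x R))"
      using RX unfolding X_def by blast
    then have "1 < card (P \<inter> cball x R)"
      using n by (simp add: n_def)
    then obtain p q where pq: "p \<in> P \<inter> cball x R" "q \<in> P \<inter> cball x R" "p \<noteq> q"
      by (metis One_nat_def card_le_Suc0_iff_eq fin finite_Int not_le)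
    have "d \<le> dist p q"
      using d pq by auto
    also have "\<dots> \<le> dist x p + dist x q"
      by (metis dist_commute dist_triangle)
    finally show ?thesis
      using pq by auto
  qed
  have ne: "X \<noteq> {}"
  proof -
    obtain x e where "P \<subseteq> cball x e"
      using finite_imp_bounded[OF fin] bounded_subset_cball by blast
    then have "P \<inter> cball x e = P"
      by auto
    then have "e \<in> X"
      unfolding X_def n_def by (auto intro!: exI[of _ x])
    then show ?thesis by auto
  qed
  have bdd: "bdd_below X"
    using lower unfolding bdd_below_def by blast
  have "d / 2 \<le> R0"
    unfolding R0_def using ne lower by (rule cInf_greatest)
  then have pos: "0 < R0"
    using d by simp
  have "\<exists>R\<in>X. R < 3/2 * R0"
    using cInf_lessD[OF ne, of "3/2 * R0"] pos by (auto simp: R0_def)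
  then obtain R x where R: "R < 3/2 * R0" "n / 8 \<le> real (card (P \<inter> cball x R))"
    unfolding X_def by blast
  obtain D :: "(real^2) set" where D: "card D \<le> 7" "finite D"
    "\<And>(x::real^2) r. 0 \<le> r \<Longrightarrow> cball x (2 * r) \<subseteq> (\<Union>u\<in>D. cball (x + r *\<^sub>R u) r)"
    using disc_covered_by_seven by blast
  have "n / 8 \<le> real (card (P \<inter> ball x r)) \<and> n / 8 \<le> real (card (P - cball x r))"
    if r: "3/2 * R0 < r" "r < 2 * R0" for r
  proof
    have "card (P \<inter> cball x R) \<le> card (P \<inter> ball x r)"
      using fin R r by (intro card_mono) auto
    then show "n / 8 \<le> real (card (P \<inter> ball x r))"
      using R by linarith
    have small: "real (card (P \<inter> cball y (r/2))) \<le> n / 8" for y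
    proof (rule ccontr)
      assume "\<not> ?thesis"
      then have "r / 2 \<in> X"
        unfolding X_def by (auto intro!: exI[of _ y])
      then have "R0 \<le> r / 2"
        unfolding R0_def using bdd by (rule cInf_lower)
      then show False
        using r by simp
    qed
    have "P \<inter> cball x r \<subseteq> (\<Union>u\<in>D. P \<inter> cball (x + (r/2) *\<^sub>R u) (r/2))"
      using D(3)[of "r/2" x] r pos by auto
    then have "card (P \<inter> cball x r) \<le> card (\<Union>u\<in>D. P \<inter> cball (x + (r/2) *\<^sub>R u) (r/2))"
      using fin D by (intro card_mono) auto
    also have "\<dots> \<le> (\<Sum>u\<in>D. card (P \<inter> cball (x + (r/2) *\<^sub>R u) (r/2)))"
      using D by (intro card_UN_le)
    finally have "real (card (P \<inter> cball x r)) \<le> (\<Sum>u\<in>D. real (card (P \<inter> cball (x + (r/2) *\<^sub>R u) (r/2))))"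
      by (metis of_nat_le_iff of_nat_sum)
    \<comment> \<open>Seven small discs hold at most seven eighths of the points, which leaves one
      eighth outside.\<close>
    also have "\<dots> \<le> (\<Sum>u\<in>D. n / 8)"
      by (intro sum_mono small)
    also have "\<dots> \<le> 7 * (n / 8)"
      using D by (simp add: n_def mult_right_mono)
    finally have "real (card (P \<inter> cball x r)) \<le> 7 * n / 8"
      by simp
    moreover have "real (card (P - cball x r)) = n - real (card (P \<inter> cball x r))"
      using card_Diff_subset_Int[of P "cball x r"] fin card_mono[OF fin, of "P \<inter> cball x r"]
      by (simp add: n_def)
    ultimately show "n / 8 \<le> real (card (P - cball x r))"
      by linarith
  qed
  then show thesis
    using that[OF pos, of x] by (simp add: n_def)
qed

subsection \<open>Rectilinear networks\<close>

lemma diameter_closed_segment: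
  fixes a b :: "'a::euclidean_space"
  shows "diameter (closed_segment a b) = dist a b"
proof (rule antisym)
  show "diameter (closed_segment a b) \<le> dist a b"
  proof (rule diameter_le)
    fix x y assume "x \<in> closed_segment a b" "y \<in> closed_segment a b"
    then obtain s t where st: "0 \<le> s" "s \<le> 1" "x = (1 - s) *\<^sub>R a + s *\<^sub>R b"
      "0 \<le> t" "t \<le> 1" "y = (1 - t) *\<^sub>R a + t *\<^sub>R b"
      by (auto simp: in_segment)
    then have "x - y = (s - t) *\<^sub>R (b - a)"
      unfolding st by (simp add: algebra_simps)
    then have "norm (x - y) = \<bar>s - t\<bar> * dist a b"
      by (simp add: dist_norm norm_minus_commute)
    also have "\<dots> \<le> 1 * dist a b"
      using st by (intro mult_right_mono) auto
    finally show "norm (x - y) \<le> dist a b"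
      by simp
  qed auto
  show "dist a b \<le> diameter (closed_segment a b)"
    by (intro diameter_bounded_bound bounded_closed_segment) auto
qed

lemma rect_seg_compact: "rect_seg s \<Longrightarrow> compact s"
  by (auto simp: rect_seg_def)

lemma diameter_rect_seg_nonneg: "rect_seg s \<Longrightarrow> 0 \<le> diameter s"
  by (auto simp: rect_seg_def diameter_closed_segment)

text \<open>Only an inequality, since a segment shared by both sets is summed once.\<close>

lemma network_length_Un:
  assumes "finite A" "finite B" "\<forall>s\<in>A \<union> B. rect_seg s"
  shows "network_length (A \<union> B) \<le> network_length A + network_length B"
proof -
  have "network_length (A \<union> B) = network_length A + network_length B - (\<Sum>s\<in>A \<inter> B. diameter s)"
    unfolding network_length_def using assms(1,2) by (rule sum_Un)
  moreover have "0 \<le> (\<Sum>s\<in>A \<inter> B. diameter s)"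
    using assms(3) by (intro sum_nonneg diameter_rect_seg_nonneg) auto
  ultimately show ?thesis by simp
qed

lemma rect_network_add_segment:
  assumes "rect_network G W" "q \<in> \<Union>W" "q $ 1 = p $ 1 \<or> q $ 2 = p $ 2"
  obtains W' where "W \<subseteq> W'" "rect_network (insert p G) W'"
    "network_length W' \<le> network_length W + dist q p"
proof (cases "p = q")
  \<comment> \<open>A degenerate segment is not a \<open>rect_seg\<close>, so here the network stays
    as it is.\<close>
  case True
  then show thesis
    using assms by (intro that[of W]) (auto simp: rect_network_def)
next
  case False
  let ?s = "closed_segment q p"
  have s: "rect_seg ?s"
    unfolding rect_seg_def by (rule exI[of _ q], rule exI[of _ p]) (use False assms(3) in auto)
  have "connected (\<Union>W \<union> ?s)"
    using assms by (intro connected_Un) (auto simp: rect_network_def)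
  then have "rect_network (insert p G) (W \<union> {?s})"
    using assms(1) s by (auto simp: rect_network_def Un_commute)
  moreover have "network_length (W \<union> {?s}) \<le> network_length W + network_length {?s}"
    using assms(1) s by (intro network_length_Un) (auto simp: rect_network_def)
  ultimately show thesis
    by (intro that[of "W \<union> {?s}"]) (auto simp: network_length_def diameter_closed_segment)
qed

text \<open>An L-shaped path through the corner \<open>m\<close> does it; each leg is at most
  \<open>dist p q\<close>.\<close>

lemma rect_network_add_point:
  assumes "rect_network G W" "q \<in> \<Union>W"
  obtains W' where "W \<subseteq> W'" "rect_network (insert p G) W'"
    "network_length W' \<le> network_length W + 2 * dist p q"
proof -
  define m :: "real^2" where "m = vector [p$1, q$2]"
  obtain W1 where W1: "W \<subseteq> W1" "rect_network (insert m G) W1"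
    "network_length W1 \<le> network_length W + dist q m"
    using rect_network_add_segment[OF assms, of m] by (auto simp: m_def)
  have "m \<in> \<Union>W1"
    using W1 by (auto simp: rect_network_def)
  then obtain W2 where W2: "W1 \<subseteq> W2" "rect_network (insert p (insert m G)) W2"
    "network_length W2 \<le> network_length W1 + dist m p"
    using rect_network_add_segment[OF W1(2), of m p] by (auto simp: m_def)
  have "dist q m \<le> dist p q" "dist m p \<le> dist p q"
    by (auto simp: dist_real2 m_def power2_commute)
  moreover have "rect_network (insert p G) W2"
    using W2(2) by (auto simp: rect_network_def)
  ultimately show thesis
    using W1 W2 by (intro that[of W2]) auto
qed

text \<open>Every point is joined directly to \<open>G\<close>, which stays among the terminals
  throughout the induction, so errors do not accumulate.\<close>

lemma rect_network_add_points:
  assumes "finite A" "rect_network G W" "\<And>p. p \<in> A \<Longrightarrow> \<exists>q\<in>G. dist p q \<le> e"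
  shows "\<exists>W'. W \<subseteq> W' \<and> rect_network (A \<union> G) W' \<and>
    network_length W' \<le> network_length W + 2 * e * real (card A)"
  using assms(1,3)
proof (induction A rule: finite_induct)
  case empty
  then show ?case
    using assms(2) by auto
next
  case (insert p A)
  then obtain W' where W': "W \<subseteq> W'" "rect_network (A \<union> G) W'"
    "network_length W' \<le> network_length W + 2 * e * real (card A)"
    by auto
  obtain q where q: "q \<in> G" "dist p q \<le> e"
    using insert.prems by auto
  then have "q \<in> \<Union>W'"
    using W' by (auto simp: rect_network_def)
  then obtain W2 where W2: "W' \<subseteq> W2" "rect_network (insert p (A \<union> G)) W2"
    "network_length W2 \<le> network_length W' + 2 * dist p q"
    using rect_network_add_point[OF W'(2)] by metis
  have "network_length W2 \<le> network_length W + 2 * e * real (card (insert p A))"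
    using W2 W' q insert.hyps by (auto simp: algebra_simps)
  then show ?case
    using W2 W' by (intro exI[of _ W2]) auto
qed

text \<open>The sides run counterclockwise from the lower left corner, so consecutive segments share
  an endpoint.\<close>

definition square_sides :: "real^2 \<Rightarrow> real \<Rightarrow> (real^2) set set" where
  "square_sides x h =
    (let u = x$1 - h; v = x$1 + h; w = x$2 - h; z = x$2 + h in
     {closed_segment (vector [u, w]) (vector [v, w]), closed_segment (vector [v, w]) (vector [v, z]),
      closed_segment (vector [v, z]) (vector [u, z]), closed_segment (vector [u, z]) (vector [u, w])})"

lemma mem_square: "p \<in> cbox (x - vec h) (x + vec h) \<longleftrightarrow> \<bar>p$1 - x$1\<bar> \<le> h \<and> \<bar>p$2 - x$2\<bar> \<le> h" for p x :: "real^2"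
  by (auto simp: mem_box_cart forall_2 abs_le_iff)

lemma horizontal_segment:
  "closed_segment (vector [a, y]) (vector [b, y]) = {p :: real^2. p$1 \<in> closed_segment a b \<and> p$2 = y}"
proof (intro equalityI subsetI)
  fix p :: "real^2" assume "p \<in> {p. p$1 \<in> closed_segment a b \<and> p$2 = y}"
  then obtain t where "0 \<le> t" "t \<le> 1" "p$1 = (1 - t) * a + t * b" "p$2 = y"
    by (auto simp: in_segment)
  then show "p \<in> closed_segment (vector [a, y]) (vector [b, y])"
    by (auto simp: in_segment vec_eq_iff forall_2 algebra_simps intro!: exI[of _ t])
qed (auto simp: in_segment, auto simp: algebra_simps)

lemma vertical_segment:
  "closed_segment (vector [y, a]) (vector [y, b]) = {p :: real^2. p$2 \<in> closed_segment a b \<and> p$1 = y}"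
proof (intro equalityI subsetI)
  fix p :: "real^2" assume "p \<in> {p. p$2 \<in> closed_segment a b \<and> p$1 = y}"
  then obtain t where "0 \<le> t" "t \<le> 1" "p$2 = (1 - t) * a + t * b" "p$1 = y"
    by (auto simp: in_segment)
  then show "p \<in> closed_segment (vector [y, a]) (vector [y, b])"
    by (auto simp: in_segment vec_eq_iff forall_2 algebra_simps intro!: exI[of _ t])
qed (auto simp: in_segment, auto simp: algebra_simps)

lemma square_sides_Union:
  assumes "0 < h"
  shows "\<Union>(square_sides x h) = {p. \<bar>p$1 - x$1\<bar> \<le> h \<and> \<bar>p$2 - x$2\<bar> \<le> h \<and>
     (\<bar>p$1 - x$1\<bar> = h \<or> \<bar>p$2 - x$2\<bar> = h)}"
proof (rule set_eqI)
  fix p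
  have "p \<in> \<Union>(square_sides x h) \<longleftrightarrow>
     x$1 - h \<le> p$1 \<and> p$1 \<le> x$1 + h \<and> p$2 = x$2 - h \<or> x$2 - h \<le> p$2 \<and> p$2 \<le> x$2 + h \<and> p$1 = x$1 + h \<or>
     x$1 - h \<le> p$1 \<and> p$1 \<le> x$1 + h \<and> p$2 = x$2 + h \<or> x$2 - h \<le> p$2 \<and> p$2 \<le> x$2 + h \<and> p$1 = x$1 - h"
    using assms unfolding square_sides_def Let_def Union_insert horizontal_segment vertical_segment
    by (simp add: closed_segment_eq_real_ivl)
  also have "\<dots> \<longleftrightarrow> \<bar>p$1 - x$1\<bar> \<le> h \<and> \<bar>p$2 - x$2\<bar> \<le> h \<and> (\<bar>p$1 - x$1\<bar> = h \<or> \<bar>p$2 - x$2\<bar> = h)"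
    using assms by (smt (verit))
  finally show "p \<in> \<Union>(square_sides x h) \<longleftrightarrow> p \<in> {p. \<bar>p$1 - x$1\<bar> \<le> h \<and> \<bar>p$2 - x$2\<bar> \<le> h \<and>
     (\<bar>p$1 - x$1\<bar> = h \<or> \<bar>p$2 - x$2\<bar> = h)}"
    by simp
qed

text \<open>One corner is named as a terminal because the coarsest net is later attached to
  it.\<close>

lemma rect_network_square_sides:
  assumes "0 < h"
  shows "rect_network {vector [x$1 - h, x$2 - h]} (square_sides x h)"
proof -
  have "rect_seg (closed_segment (vector [a, y]) (vector [b, y]))"
    "rect_seg (closed_segment (vector [y, a]) (vector [y, b]))" if "a \<noteq> b" for a b y :: real
    using that unfolding rect_seg_def by (metis vector_2)+
  then have seg: "rect_seg s" if "s \<in> square_sides x h" for s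
    using that assms by (auto simp: square_sides_def Let_def)
  have "connected (\<Union>(square_sides x h))"
  proof -
    have U: "connected (closed_segment a b \<union> (closed_segment b d \<union> (closed_segment d e \<union> closed_segment e a)))"
      for a b d e :: "real^2"
      by (intro connected_Un connected_segment) auto
    show ?thesis
      unfolding square_sides_def Let_def Union_insert Union_empty Un_empty_right by (rule U)
  qed
  moreover have "vector [x$1 - h, x$2 - h] \<in> \<Union>(square_sides x h)"
    using assms by (simp add: square_sides_Union)
  moreover have "finite (square_sides x h)"
    by (simp add: square_sides_def Let_def)
  ultimately show ?thesis
    using seg by (auto simp: rect_network_def)
qed

lemma network_length_square_sides:
  assumes "0 < h"
  shows "network_length (square_sides x h) \<le> 8 * h"
proof -
  have d: "dist (vector [a, y] :: real^2) (vector [b, y]) = \<bar>a - b\<bar>"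
    "dist (vector [y, a] :: real^2) (vector [y, b]) = \<bar>a - b\<bar>" for a b y :: real
    by (auto simp: dist_real2)
  \<comment> \<open>An inequality, as the four sets are not assumed distinct. It needs a function
    nonnegative on every set, hence the absolute value in \<open>f\<close> below.\<close>
  have *: "sum f {a, b, c, d} \<le> f a + f b + f c + f d"
    if "\<And>s. 0 \<le> f s" for a b c d :: "(real^2) set" and f :: "_ \<Rightarrow> real"
    using that by (auto simp: sum.insert_if add_increasing add_increasing2)
  define f where "f s = \<bar>diameter s\<bar>" for s :: "(real^2) set"
  have "network_length (square_sides x h) = sum f (square_sides x h)"
    unfolding network_length_def f_def
    using rect_network_square_sides[OF assms, of x]
    by (intro sum.cong) (auto simp: rect_network_def diameter_rect_seg_nonneg)
  also have "\<dots> \<le> 8 * h"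
    unfolding square_sides_def Let_def
    by (rule order_trans[OF *]) (use assms in \<open>auto simp: f_def diameter_closed_segment d\<close>)
  finally show ?thesis .
qed

lemma frontier_square_subset:
  assumes "0 < h"
  shows "frontier (cbox (x - vec h) (x + vec h)) \<subseteq> \<Union>(square_sides x h)"
proof -
  have "\<And>p. p \<in> box (x - vec h) (x + vec h) \<longleftrightarrow> \<bar>p$1 - x$1\<bar> < h \<and> \<bar>p$2 - x$2\<bar> < h"
    by (auto simp: mem_box_cart forall_2 abs_less_iff)
  then have "p \<in> \<Union>(square_sides x h)" if "p \<in> cbox (x - vec h) (x + vec h)" "p \<notin> box (x - vec h) (x + vec h)" for p
    using that unfolding square_sides_Union[OF assms] mem_square by force
  then show ?thesis
    unfolding frontier_def interior_cbox closure_closed[OF closed_cbox] by blast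
qed

subsection \<open>Exchanging a minimal network inside a square\<close>

text \<open>Replacing the part of \<open>Y\<close> inside \<open>C\<close> by the connected set
  \<open>F\<close> preserves connectedness. If closed sets split \<open>X\<close>, then
  \<open>F\<close> lies in one of them. The other part of \<open>X\<close> avoids \<open>F\<close>,
  hence \<open>C\<close>, so it would also split off from \<open>Y\<close>.\<close>

lemma connected_excise:
  assumes Y: "connected Y" and C: "closed C" and X: "closed X" and F: "connected F"
    and FX: "F \<subseteq> X" and XF: "X \<inter> C \<subseteq> F" and XY: "X \<subseteq> Y \<union> C" and YX: "Y \<subseteq> X \<union> C" and YC: "Y \<inter> C \<noteq> {}"
  shows "connected X"
proof -
  have no_split: False
    if A: "closed A" and B: "closed B" and cov: "X \<subseteq> A \<union> B" and disj: "A \<inter> B \<inter> X = {}"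
      and ne: "B \<inter> X \<noteq> {}" and FB: "F \<inter> B = {}" for A B
  proof -
    have "closed (X \<inter> B)" "closed (X \<inter> A \<union> C)"
      using A B X C by auto
    moreover have "Y \<subseteq> (X \<inter> B) \<union> (X \<inter> A \<union> C)"
      using YX cov by blast
    moreover have "(X \<inter> B) \<inter> (X \<inter> A \<union> C) \<inter> Y = {}"
      using disj XF FB by blast
    moreover have "(X \<inter> B) \<inter> Y \<noteq> {}"
      using ne XY XF FB by blast
    moreover have "(X \<inter> A \<union> C) \<inter> Y \<noteq> {}"
      using YC by blast
    ultimately show False
      using Y unfolding connected_closed by blast
  qed
  show ?thesis
    unfolding connected_closed
  proof (intro notI, elim exE conjE)
    fix A B assume A: "closed A" and B: "closed B" and cov: "X \<subseteq> A \<union> B" and disj: "A \<inter> B \<inter> X = {}"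
      and ne: "A \<inter> X \<noteq> {}" "B \<inter> X \<noteq> {}"
    have "F \<inter> A = {} \<or> F \<inter> B = {}"
      using connected_closedD[OF F, of A B] disj cov FX A B by blast
    then show False
      using no_split[OF A B cov disj ne(2)] no_split[OF B A _ _ ne(1)] cov disj by blast
  qed
qed

text \<open>Here \<open>t\<close> is the first parameter at which the segment enters
  \<open>B\<close>. The result is a set of segments because nothing remains when
  \<open>t = 0\<close>. Abstracting \<open>g\<close> allows the use from either end of a
  segment.\<close>

lemma rect_seg_end_piece:
  fixes a b :: "real^2"
  assumes g: "\<And>u. g u = (1 - u) *\<^sub>R a + u *\<^sub>R b"
    and ab: "a \<noteq> b" "a$1 = b$1 \<or> a$2 = b$2" and B: "closed B"
    and t: "0 \<le> t" "t \<le> 1" "g t \<in> B" "\<And>u. 0 \<le> u \<Longrightarrow> u < t \<Longrightarrow> g u \<notin> B"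
  obtains T where "finite T" "\<And>s. s \<in> T \<Longrightarrow> rect_seg s \<and> s \<subseteq> closed_segment a b \<and> s \<inter> B \<subseteq> frontier B"
    "g ` {0..<t} \<subseteq> \<Union>T" "network_length T = t * dist a b"
proof (cases "t = 0")
  case True
  then show thesis
    by (intro that[of "{}"]) (auto simp: network_length_def)
next
  case False
  let ?U = "closed_segment a (g t)"
  have gt: "g t - a = t *\<^sub>R (b - a)"
    by (simp add: g algebra_simps)
  have U: "?U = g ` {0..t}"
  proof (intro equalityI subsetI)
    fix z assume "z \<in> ?U"
    then obtain v where v: "0 \<le> v" "v \<le> 1" "z = (1 - v) *\<^sub>R a + v *\<^sub>R g t"
      by (auto simp: in_segment)
    have "z = g (v * t)"
      unfolding v g by (simp add: algebra_simps)
    moreover have "v * t \<le> t"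
      using v t by (simp add: mult_left_le_one_le)
    ultimately show "z \<in> g ` {0..t}"
      using v t by (intro image_eqI[of _ _ "v * t"]) auto
  next
    fix z assume "z \<in> g ` {0..t}"
    then obtain v where v: "0 \<le> v" "v \<le> t" "z = g v"
      by auto
    have "z = (1 - v / t) *\<^sub>R a + (v / t) *\<^sub>R g t"
      unfolding v g using False by (simp add: algebra_simps)
    then show "z \<in> ?U"
      using v t False by (auto simp: in_segment intro!: exI[of _ "v / t"])
  qed
  have UB: "?U \<inter> B \<subseteq> {g t}"
    unfolding U using t(4) by force
  have "a \<notin> B"
    using t(4)[of 0] False t by (simp add: g)
  \<comment> \<open>A connected set with a point outside \<open>B\<close> and one inside meets the
    frontier; the only point of \<open>?U\<close> in \<open>B\<close> is \<open>g t\<close>.\<close>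
  then have "?U \<inter> frontier B \<noteq> {}"
    using t by (intro connected_Int_frontier) auto
  then have "g t \<in> frontier B"
    using UB frontier_subset_closed[OF B] by auto
  moreover have "rect_seg ?U"
  proof -
    have "g t \<noteq> a"
      using gt False ab by auto
    moreover have "a $ 1 = g t $ 1 \<or> a $ 2 = g t $ 2"
      using ab(2) by (auto simp: g algebra_simps)
    ultimately show ?thesis
      unfolding rect_seg_def by (intro exI[of _ a] exI[of _ "g t"]) auto
  qed
  moreover have "?U \<subseteq> closed_segment a b"
  proof
    fix z assume "z \<in> ?U"
    then obtain u where "u \<in> {0..t}" "z = g u"
      unfolding U by blast
    then show "z \<in> closed_segment a b"
      using t by (auto simp: g in_segment)
  qed
  moreover have "dist a (g t) = t * dist a b"
    using gt t by (metis abs_of_nonneg dist_commute dist_norm norm_scaleR)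
  moreover have "g ` {0..<t} \<subseteq> ?U"
    unfolding U by auto
  ultimately show thesis
    using UB by (intro that[of "{?U}"]) (auto simp: network_length_def diameter_closed_segment)
qed

text \<open>By convexity the parameters with values in \<open>B\<close> form an interval
  \<open>{t1..t2}\<close>. The end pieces have shares \<open>t1\<close> and \<open>1 - t2\<close> of
  the length, and the part in \<open>B\<close> has at most \<open>t2 - t1\<close>.\<close>

lemma rect_seg_clip:
  assumes s: "rect_seg s" and B: "closed B" "convex B"
  obtains T where "finite T" "\<And>t. t \<in> T \<Longrightarrow> rect_seg t \<and> t \<subseteq> s \<and> t \<inter> B \<subseteq> frontier B"
    "s \<subseteq> \<Union>T \<union> B" "network_length T + diameter (s \<inter> B) \<le> diameter s"
proof (cases "s \<inter> B = {}")
  case True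
  \<comment> \<open>\<open>diameter {}\<close> is 0, so \<open>s\<close> itself serves as the only
    piece.\<close>
  then show thesis
    using s by (intro that[of "{s}"]) (auto simp: network_length_def)
next
  case False
  obtain a b where ab: "a \<noteq> b" "a$1 = b$1 \<or> a$2 = b$2" and s_def: "s = closed_segment a b"
    using s by (auto simp: rect_seg_def)
  define g where "g u = (1 - u) *\<^sub>R a + u *\<^sub>R b" for u
  have sg: "s = g ` {0..1}"
    by (auto simp: s_def in_segment g_def)
  define Z where "Z = {u \<in> {0..1}. g u \<in> B}"
  have cont: "continuous_on {0..1} g"
    unfolding g_def by (intro continuous_intros)
  have "closed Z"
    using continuous_on_closed_vimage[of "{0..1}" g] cont B(1) by (auto simp: Z_def vimage_def Int_def conj_commute)
  then have "compact Z"
    using compact_Int_closed[OF compact_Icc, of Z 0 1] by (simp add: Z_def Int_def conj_ac cong: conj_cong)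
  moreover have "convex Z"
    unfolding convex_alt
  proof (intro ballI allI impI)
    fix u v w :: real assume uv: "u \<in> Z" "v \<in> Z" and w: "0 \<le> w \<and> w \<le> 1"
    have "g ((1 - w) *\<^sub>R u + w *\<^sub>R v) = (1 - w) *\<^sub>R g u + w *\<^sub>R g v"
      by (simp add: g_def algebra_simps)
    moreover have "(1 - w) *\<^sub>R g u + w *\<^sub>R g v \<in> B"
      using B(2) uv w unfolding convex_alt Z_def by blast
    moreover have "(1 - w) *\<^sub>R u + w *\<^sub>R v \<in> {0..1}"
      using convex_real_interval(5)[of 0 1] uv w unfolding convex_alt Z_def by blast
    ultimately show "(1 - w) *\<^sub>R u + w *\<^sub>R v \<in> Z"
      by (simp add: Z_def)
  qed
  ultimately obtain t1 t2 where Z: "Z = {t1..t2}"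
    using connected_compact_interval_1 convex_connected by metis
  have "Z \<noteq> {}"
    using False by (auto simp: sg Z_def)
  then have t12: "t1 \<le> t2" "t1 \<in> Z" "t2 \<in> Z"
    using Z by auto
  have inZ: "t1 \<le> u \<and> u \<le> t2 \<longleftrightarrow> u \<in> {0..1} \<and> g u \<in> B" for u
    unfolding atLeastAtMost_iff[of u t1 t2, symmetric] Z[symmetric] by (simp add: Z_def)
  have "0 \<le> t1" "t1 \<le> 1" "g t1 \<in> B" "\<And>u. 0 \<le> u \<Longrightarrow> u < t1 \<Longrightarrow> g u \<notin> B"
  proof -
    show "0 \<le> t1" "t1 \<le> 1" "g t1 \<in> B"
      using t12 by (auto simp: Z_def)
    fix u assume "0 \<le> u" "u < t1"
    then show "g u \<notin> B"
      using inZ[of u] t12 by (auto simp: Z_def)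
  qed
  then obtain T1 where T1: "finite T1" "\<And>t. t \<in> T1 \<Longrightarrow> rect_seg t \<and> t \<subseteq> closed_segment a b \<and> t \<inter> B \<subseteq> frontier B"
    "g ` {0..<t1} \<subseteq> \<Union>T1" "network_length T1 = t1 * dist a b"
    using rect_seg_end_piece[OF g_def ab B(1), of t1] by blast
  \<comment> \<open>Traversing the segment backwards turns the last exit from \<open>B\<close> into
    a first entry.\<close>
  define g' where "g' u = (1 - u) *\<^sub>R b + u *\<^sub>R a" for u
  have g': "g' u = g (1 - u)" for u
    by (simp add: g_def g'_def)
  have "0 \<le> 1 - t2" "1 - t2 \<le> 1" "g' (1 - t2) \<in> B" "\<And>u. 0 \<le> u \<Longrightarrow> u < 1 - t2 \<Longrightarrow> g' u \<notin> B"
  proof -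
    show "0 \<le> 1 - t2" "1 - t2 \<le> 1" "g' (1 - t2) \<in> B"
      using t12 by (auto simp: g' Z_def)
    fix u assume "0 \<le> u" "u < 1 - t2"
    then show "g' u \<notin> B"
      using inZ[of "1 - u"] t12 by (auto simp: g' Z_def)
  qed
  then obtain T2 where T2: "finite T2" "\<And>t. t \<in> T2 \<Longrightarrow> rect_seg t \<and> t \<subseteq> closed_segment b a \<and> t \<inter> B \<subseteq> frontier B"
    "g' ` {0..<1 - t2} \<subseteq> \<Union>T2" "network_length T2 = (1 - t2) * dist b a"
    using rect_seg_end_piece[OF g'_def ab(1)[symmetric] _ B(1), of "1 - t2"] ab(2) by metis
  show thesis
  proof (rule that[of "T1 \<union> T2"])
    show "finite (T1 \<union> T2)"
      using T1 T2 by simp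
    show "rect_seg t \<and> t \<subseteq> s \<and> t \<inter> B \<subseteq> frontier B" if "t \<in> T1 \<union> T2" for t
      using that T1(2) T2(2) unfolding s_def closed_segment_commute[of b a] by blast
    show "s \<subseteq> \<Union>(T1 \<union> T2) \<union> B"
    proof
      fix z assume "z \<in> s"
      then obtain u where u: "u \<in> {0..1}" "z = g u"
        by (auto simp: sg)
      consider "u < t1" | "t1 \<le> u \<and> u \<le> t2" | "t2 < u"
        by linarith
      then show "z \<in> \<Union>(T1 \<union> T2) \<union> B"
      proof cases
        case 1
        then have "z \<in> g ` {0..<t1}"
          using u by auto
        then show ?thesis
          using T1(3) by blast
      next
        case 2
        then show ?thesis
          using inZ u by blast
      next
        case 3
        then have "z = g' (1 - u)" "1 - u \<in> {0..<1 - t2}"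
          using u by (auto simp: g')
        then show ?thesis
          using T2(3) by blast
      qed
    qed
    have "diameter (s \<inter> B) \<le> (t2 - t1) * dist a b"
    proof (rule diameter_le)
      show "s \<inter> B \<noteq> {} \<or> 0 \<le> (t2 - t1) * dist a b"
        using False by simp
      fix y z assume "y \<in> s \<inter> B" "z \<in> s \<inter> B"
      then obtain u v where uv: "y = g u" "z = g v" "u \<in> Z" "v \<in> Z"
        by (auto simp: sg Z_def)
      then have "y - z = (u - v) *\<^sub>R (b - a)"
        unfolding uv g_def by (simp add: algebra_simps)
      then have "norm (y - z) = \<bar>u - v\<bar> * dist a b"
        by (simp add: dist_norm norm_minus_commute)
      also have "\<dots> \<le> (t2 - t1) * dist a b"
        using uv Z by (intro mult_right_mono) auto
      finally show "norm (y - z) \<le> (t2 - t1) * dist a b" .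
    qed
    moreover have "network_length (T1 \<union> T2) \<le> t1 * dist a b + (1 - t2) * dist a b"
      using network_length_Un[of T1 T2] T1 T2 by (auto simp: dist_commute)
    ultimately show "network_length (T1 \<union> T2) + diameter (s \<inter> B) \<le> diameter s"
      by (simp add: s_def diameter_closed_segment algebra_simps)
  qed
qed

lemma network_length_UN:
  assumes "finite S" "\<And>s. s \<in> S \<Longrightarrow> finite (T s) \<and> (\<forall>t\<in>T s. rect_seg t)"
  shows "network_length (\<Union>s\<in>S. T s) \<le> (\<Sum>s\<in>S. network_length (T s))"
  using assms
proof (induction S rule: finite_induct)
  case empty
  then show ?case
    by (simp add: network_length_def)
next
  case (insert s S)
  then have "network_length (T s \<union> (\<Union>s\<in>S. T s)) \<le> network_length (T s) + network_length (\<Union>s\<in>S. T s)"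
    by (intro network_length_Un) auto
  with insert show ?case
    by fastforce
qed

text \<open>The pieces of \<open>S\<close> outside the square together with \<open>W\<close> form a
  competing network for \<open>P\<close>. Deleting the inside may disconnect the pieces, but the
  sides contained in \<open>W\<close> join them again.\<close>

lemma rsmt_length_in_square:
  assumes S: "rsmt P S" and h: "0 < h" and PB: "P \<inter> cbox (x - vec h) (x + vec h) \<noteq> {}"
    and sides: "square_sides x h \<subseteq> W" and W: "rect_network (P \<inter> cbox (x - vec h) (x + vec h)) W"
  shows "(\<Sum>s\<in>S. diameter (s \<inter> cbox (x - vec h) (x + vec h))) \<le> network_length W"
proof -
  define B where "B = cbox (x - vec h) (x + vec h)"
  define F where "F = \<Union>(square_sides x h)"
  have netS: "finite S" "\<And>s. s \<in> S \<Longrightarrow> rect_seg s" "P \<subseteq> \<Union>S" "connected (\<Union>S)"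
    using S by (auto simp: rsmt_def rect_network_def)
  have netW: "finite W" "\<And>s. s \<in> W \<Longrightarrow> rect_seg s" "P \<inter> B \<subseteq> \<Union>W" "connected (\<Union>W)"
    using W by (auto simp: rect_network_def B_def)
  have netF: "finite (square_sides x h)" "\<And>s. s \<in> square_sides x h \<Longrightarrow> rect_seg s" "connected F" "F \<noteq> {}"
    using rect_network_square_sides[OF h, of x] by (auto simp: rect_network_def F_def)
  have FB: "F \<subseteq> B" "frontier B \<subseteq> F"
    using frontier_square_subset[OF h, of x]
    by (auto simp: F_def B_def mem_square square_sides_Union[OF h])
  have "\<forall>s\<in>S. \<exists>T. finite T \<and> (\<forall>t\<in>T. rect_seg t \<and> t \<subseteq> s \<and> t \<inter> B \<subseteq> frontier B) \<and>
    s \<subseteq> \<Union>T \<union> B \<and> network_length T + diameter (s \<inter> B) \<le> diameter s"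
    using rect_seg_clip[OF netS(2)] unfolding B_def
    by (metis closed_cbox convex_box(1))
  then obtain T where T: "\<And>s. s \<in> S \<Longrightarrow> finite (T s)"
    "\<And>s t. s \<in> S \<Longrightarrow> t \<in> T s \<Longrightarrow> rect_seg t \<and> t \<subseteq> s \<and> t \<inter> B \<subseteq> frontier B"
    "\<And>s. s \<in> S \<Longrightarrow> s \<subseteq> \<Union>(T s) \<union> B"
    "\<And>s. s \<in> S \<Longrightarrow> network_length (T s) + diameter (s \<inter> B) \<le> diameter s"
    by metis
  define V where "V = (\<Union>s\<in>S. T s)"
  have V: "finite V" "\<And>t. t \<in> V \<Longrightarrow> rect_seg t" "\<Union>V \<subseteq> \<Union>S" "\<Union>V \<inter> B \<subseteq> F" "\<Union>S \<subseteq> \<Union>V \<union> B"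
  proof -
    show "finite V" "\<And>t. t \<in> V \<Longrightarrow> rect_seg t"
      using T(1,2) netS(1) by (auto simp: V_def)
    show "\<Union>V \<subseteq> \<Union>S" "\<Union>V \<inter> B \<subseteq> F"
      using T(2) FB unfolding V_def by blast+
    show "\<Union>S \<subseteq> \<Union>V \<union> B"
      using T(3) unfolding V_def by blast
  qed
  \<comment> \<open>Excision with \<open>\<Union>S\<close> as the old connected set and the boundary
    \<open>F\<close> as replacement. A point of \<open>P\<close> in the square shows that the tree
    meets it.\<close>
  have VF: "connected (\<Union>V \<union> F)"
  proof (rule connected_excise[OF netS(4)])
    show "closed B"
      unfolding B_def by (rule closed_cbox)
    show "closed (\<Union>V \<union> F)"
      unfolding F_def using V(1,2) netF(1,2)
      by (intro closed_Un closed_Union) (auto intro: rect_seg_compact compact_imp_closed)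
    show "\<Union>S \<inter> B \<noteq> {}"
      using PB netS(3) unfolding B_def by blast
  qed (use netF V FB in blast)+
  have FW: "F \<subseteq> \<Union>W"
    using sides by (auto simp: F_def)
  have "(\<Union>V \<union> F) \<inter> \<Union>W \<noteq> {}"
    using FW netF(4) by blast
  with VF netW(4) have "connected ((\<Union>V \<union> F) \<union> \<Union>W)"
    by (rule connected_Un)
  moreover have "\<Union>(V \<union> W) = (\<Union>V \<union> F) \<union> \<Union>W"
    using FW by auto
  moreover have "P \<subseteq> \<Union>(V \<union> W)"
    using netS(3) V(5) netW(3) by blast
  ultimately have "rect_network P (V \<union> W)"
    using V netW unfolding rect_network_def by auto
  then have "network_length S \<le> network_length (V \<union> W)"
    using S by (simp add: rsmt_def)
  also have "\<dots> \<le> network_length V + network_length W"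
    using V netW by (intro network_length_Un) auto
  also have "network_length V \<le> (\<Sum>s\<in>S. network_length (T s))"
    unfolding V_def using netS(1) T(1,2) by (intro network_length_UN) auto
  finally have "network_length S \<le> (\<Sum>s\<in>S. network_length (T s)) + network_length W"
    by simp
  \<comment> \<open>Splitting each segment into outside pieces and inside part lets the outside
    lengths cancel.\<close>
  moreover have "(\<Sum>s\<in>S. network_length (T s) + diameter (s \<inter> B)) \<le> network_length S"
    unfolding network_length_def[of S] by (intro sum_mono T(4))
  ultimately show ?thesis
    by (simp add: sum.distrib B_def)
qed

subsection \<open>Short networks from nets\<close>

text \<open>Needed because \<open>net_bound\<close> counts points in discs. The factor 2 comes from
  the l1 norm.\<close>

lemma square_subset_cball:
  assumes "0 < h"
  shows "cbox (x - vec h) (x + vec h) \<subseteq> cball (x :: real^2) (2 * h)"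
proof
  fix p :: "real^2" assume p: "p \<in> cbox (x - vec h) (x + vec h)"
  have "dist x p \<le> (\<Sum>i\<in>UNIV. \<bar>(x - p) $ i\<bar>)"
    unfolding dist_norm by (rule norm_le_l1_cart)
  also have "\<dots> \<le> 2 * h"
    using p unfolding mem_square by (simp add: sum_2 abs_minus_commute)
  finally show "p \<in> cball x (2 * h)"
    by simp
qed

lemma cball_subset_square: "cball x h \<subseteq> cbox (x - vec h) (x + vec h)" for x :: "real^2"
proof
  fix p assume "p \<in> cball x h"
  then have "norm (p - x) \<le> h"
    by (simp add: dist_norm norm_minus_commute)
  then show "p \<in> cbox (x - vec h) (x + vec h)"
    unfolding mem_square
    using component_le_norm_cart[of "p - x" 1] component_le_norm_cart[of "p - x" 2] by auto
qed

text \<open>Each point of the next net lies within \<open>h / 2 ^ k\<close> of the previous one. The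
  net at scale \<open>h / 2 ^ i\<close> has \<open>O(2 ^ i powr d)\<close> points, each joined at
  cost \<open>O(h / 2 ^ i)\<close>, which gives the geometric term.\<close>

lemma short_network_through_net:
  fixes P :: "(real^2) set" and x :: "real^2" and h :: real
  defines "A \<equiv> P \<inter> cbox (x - vec h) (x + vec h)"
  assumes P: "finite P" "net_bound d c P" and h: "0 < h"
  shows "\<exists>W M. square_sides x h \<subseteq> W \<and> eps_net A (h / 2 ^ k) M \<and> rect_network M W \<and>
    network_length W \<le> 8 * h + 8 * h * c * 2 powr d * (\<Sum>i\<le>k. (2 powr (d - 1)) ^ i)"
proof -
  have sub: "A \<subseteq> P" "A \<subseteq> cball x (2 * h)"
    using square_subset_cball[OF h, of x] by (auto simp: A_def)
  have net: "\<exists>M. finite M \<and> eps_net A (h / 2 ^ i) M \<and> real (card M) / 2 ^ i \<le> c * 2 powr d * (2 powr (d - 1)) ^ i" for i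
  proof -
    \<comment> \<open>The condition on radius and scale in \<open>net_bound\<close>; it is tight at
      \<open>i = 0\<close>.\<close>
    have "2 * (h / 2 ^ i) \<le> 2 * h"
      using h by (simp add: divide_le_eq mult_le_cancel_left1)
    then obtain M where M: "eps_net A (h / 2 ^ i) M" "real (card M) \<le> c * (2 * h / (h / 2 ^ i)) powr d"
      using net_bound_subset[OF P sub, of "h / 2 ^ i"] h by auto
    have "2 * h / (h / 2 ^ i) = 2 * 2 ^ i"
      using h by simp
    moreover have "(2 ^ i) powr d = (2 powr d) ^ i"
      by (simp add: powr_powr mult.commute flip: powr_realpow)
    ultimately have "(2 * h / (h / 2 ^ i)) powr d = 2 powr d * (2 powr d) ^ i"
      by (simp only: powr_mult)
    also have "(2 powr d) ^ i = (2 powr (d - 1)) ^ i * 2 ^ i"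
      by (simp add: powr_diff power_divide)
    finally have "real (card M) / 2 ^ i \<le> c * 2 powr d * (2 powr (d - 1)) ^ i"
      using M(2) by (simp add: divide_le_eq mult.assoc)
    moreover have "finite M"
      using M(1) sub P(1) by (meson eps_net_def finite_subset)
    ultimately show ?thesis
      using M(1) by blast
  qed
  show ?thesis
  proof (induction k)
    case 0
    obtain M where M: "finite M" "eps_net A (h / 2 ^ 0) M" "real (card M) / 2 ^ 0 \<le> c * 2 powr d * (2 powr (d - 1)) ^ 0"
      using net by blast
    define p0 :: "real^2" where "p0 = vector [x$1 - h, x$2 - h]"
    have "p0 \<in> cbox (x - vec h) (x + vec h)"
      using h unfolding mem_square by (simp add: p0_def)
    then have "dist x p0 \<le> 2 * h"
      using square_subset_cball[OF h, of x] by auto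
    \<comment> \<open>Net points and the corner both lie within \<open>2 * h\<close> of
      \<open>x\<close>. Joining them costs \<open>2 * (4 * h)\<close> per point, the source of the
      constant 8.\<close>
    then have "\<exists>q\<in>{p0}. dist p q \<le> 4 * h" if "p \<in> M" for p
      using that M(2) sub dist_triangle[of p p0 x] by (fastforce simp: eps_net_def dist_commute)
    from rect_network_add_points[OF M(1) rect_network_square_sides[OF h, of x, folded p0_def] this]
    obtain W where W: "square_sides x h \<subseteq> W" "rect_network (M \<union> {p0}) W"
      "network_length W \<le> network_length (square_sides x h) + 2 * (4 * h) * real (card M)"
      by blast
    have "2 * (4 * h) * real (card M) \<le> 2 * (4 * h) * (c * 2 powr d)"
      using M(3) h by (intro mult_left_mono) auto
    then have "network_length W \<le> 8 * h + 8 * h * c * 2 powr d"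
      using W(3) network_length_square_sides[OF h, of x] by simp
    moreover have "rect_network M W"
      using W(2) by (auto simp: rect_network_def)
    ultimately show ?case
      using W(1) M(2) by auto
  next
    case (Suc k)
    let ?q = "2 powr (d - 1)"
    obtain W M where WM: "square_sides x h \<subseteq> W" "eps_net A (h / 2 ^ k) M" "rect_network M W"
      "network_length W \<le> 8 * h + 8 * h * c * 2 powr d * (\<Sum>i\<le>k. ?q ^ i)"
      using Suc.IH by blast
    obtain M' where M': "finite M'" "eps_net A (h / 2 ^ Suc k) M'"
      "real (card M') / 2 ^ Suc k \<le> c * 2 powr d * ?q ^ Suc k"
      using net by blast
    have "\<exists>q\<in>M. dist p q \<le> h / 2 ^ k" if "p \<in> M'" for p
      using that WM(2) M'(2) unfolding eps_net_def by blast
    from rect_network_add_points[OF M'(1) WM(3) this]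
    obtain W' where W': "W \<subseteq> W'" "rect_network (M' \<union> M) W'"
      "network_length W' \<le> network_length W + 2 * (h / 2 ^ k) * real (card M')"
      by blast
    have "2 * (h / 2 ^ k) * real (card M') = 4 * h * (real (card M') / 2 ^ Suc k)"
      by simp
    \<comment> \<open>Relaxed from 4 to 8 so that base case and step share one constant.\<close>
    also have "\<dots> \<le> 8 * h * (real (card M') / 2 ^ Suc k)"
      using h by (intro mult_right_mono) auto
    also have "\<dots> \<le> 8 * h * (c * 2 powr d * ?q ^ Suc k)"
      using h M'(3) by (intro mult_left_mono) auto
    finally have "network_length W' \<le> 8 * h + 8 * h * c * 2 powr d * (\<Sum>i\<le>Suc k. ?q ^ i)"
      using W'(3) WM(4) by (simp add: algebra_simps)
    \<comment> \<open>The nets need not be nested: the old one stays covered, but only the new one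
      is kept as terminal set.\<close>
    moreover have "rect_network M' W'"
      using W'(2) by (auto simp: rect_network_def)
    ultimately show ?case
      using WM(1) W'(1) M'(2) by blast
  qed
qed

text \<open>After scale \<open>h / 2 ^ k\<close> all points in the square are joined to the last
  net, which accounts for the final summand.\<close>

lemma short_network_in_square:
  fixes P :: "(real^2) set" and x :: "real^2"
  assumes P: "finite P" "net_bound d c P" and h: "0 < h"
  obtains W where "square_sides x h \<subseteq> W" "rect_network (P \<inter> cbox (x - vec h) (x + vec h)) W"
    "network_length W \<le> 8 * h + 8 * h * c * 2 powr d * (\<Sum>i\<le>k. (2 powr (d - 1)) ^ i) + 2 * h * (real (card P) / 2 ^ k)"
proof -
  let ?A = "P \<inter> cbox (x - vec h) (x + vec h)"
  obtain W M where WM: "square_sides x h \<subseteq> W" "eps_net ?A (h / 2 ^ k) M" "rect_network M W"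
    "network_length W \<le> 8 * h + 8 * h * c * 2 powr d * (\<Sum>i\<le>k. (2 powr (d - 1)) ^ i)"
    using short_network_through_net[OF P h] by blast
  have "\<exists>q\<in>M. dist p q \<le> h / 2 ^ k" if "p \<in> ?A" for p
    using that WM(2) unfolding eps_net_def by blast
  moreover have "finite ?A"
    using P by simp
  ultimately obtain W' where W': "W \<subseteq> W'" "rect_network (?A \<union> M) W'"
    "network_length W' \<le> network_length W + 2 * (h / 2 ^ k) * real (card ?A)"
    using rect_network_add_points[OF _ WM(3)] by blast
  have "2 * (h / 2 ^ k) * real (card ?A) \<le> 2 * (h / 2 ^ k) * real (card P)"
    using h P(1) by (intro mult_left_mono of_nat_mono card_mono) auto
  moreover have "rect_network ?A W'"
    using W'(2) by (auto simp: rect_network_def)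
  ultimately show thesis
    using W' WM by (intro that[of W']) auto
qed

subsection \<open>Averaging over concentric spheres\<close>

text \<open>Integrating the covering number over \<open>(a, b)\<close> gives at most the total
  length of the intervals, so its minimum times \<open>b - a\<close> is no larger. The minimum is
  attained since the values are natural numbers.\<close>

lemma exists_rarely_covered_point:
  fixes l u :: "'a \<Rightarrow> real"
  assumes "finite S" "\<And>s. s \<in> S \<Longrightarrow> l s \<le> u s" "a < b"
  obtains r where "a < r" "r < b" "real (card {s\<in>S. r \<in> {l s..u s}}) * (b - a) \<le> (\<Sum>s\<in>S. u s - l s)"
proof -
  define m where "m r = card {s\<in>S. r \<in> {l s..u s}}" for r
  obtain r where r: "a < r \<and> r < b" and least: "\<And>r'. a < r' \<and> r' < b \<Longrightarrow> m r \<le> m r'"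
    using ex_has_least_nat[of "\<lambda>r. a < r \<and> r < b" _ m] dense[OF assms(3)] by blast
  have m: "real (m r') = (\<Sum>s\<in>S. indicat_real {l s..u s} r')" for r'
  proof -
    have "S \<inter> {s. r' \<in> {l s..u s}} = {s\<in>S. r' \<in> {l s..u s}}"
      by auto
    then show ?thesis
      using assms(1) by (simp add: m_def indicator_def sum.If_cases)
  qed
  have int: "integrable lborel (indicat_real {l s..u s})" for s
    by (cases "l s \<le> u s") (auto intro!: integrable_real_indicator)
  have "real (m r) * (b - a) = (LINT t|lborel. real (m r) * indicat_real {a<..<b} t)"
    using assms(3) by simp
  also have "\<dots> \<le> (LINT t|lborel. (\<Sum>s\<in>S. indicat_real {l s..u s} t))"
  proof (rule integral_mono)
    show "integrable lborel (\<lambda>t. real (m r) * indicat_real {a<..<b} t)"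
      using assms(3) by (intro integrable_mult_right integrable_real_indicator) auto
    show "integrable lborel (\<lambda>t. \<Sum>s\<in>S. indicat_real {l s..u s} t)"
      using int by auto
    fix t
    show "real (m r) * indicat_real {a<..<b} t \<le> (\<Sum>s\<in>S. indicat_real {l s..u s} t)"
      using least[of t] unfolding m[symmetric] by (auto simp: indicator_def)
  qed
  also have "\<dots> = (\<Sum>s\<in>S. (LINT t|lborel. indicat_real {l s..u s} t))"
    using int by (intro Bochner_Integration.integral_sum)
  also have "\<dots> = (\<Sum>s\<in>S. u s - l s)"
    using assms(2) by (intro sum.cong) auto
  finally show thesis
    using that[of r] r by (simp add: m_def)
qed

text \<open>Distance from \<open>x\<close> is 1-Lipschitz, so on \<open>s \<inter> B\<close> it
  ranges within an interval no longer than the diameter. Spheres of radius below \<open>b\<close>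
  lie in \<open>B\<close>, so all their crossings are seen there.\<close>

lemma exists_rarely_crossed_sphere:
  fixes S :: "'a::euclidean_space set set"
  assumes S: "finite S" "\<And>s. s \<in> S \<Longrightarrow> compact s" and "closed B" "cball x b \<subseteq> B" "a < b"
  obtains r where "a < r" "r < b"
    "real (card {s\<in>S. s \<inter> sphere x r \<noteq> {}}) * (b - a) \<le> (\<Sum>s\<in>S. diameter (s \<inter> B))"
proof -
  have "\<exists>l u. l \<le> u \<and> u - l \<le> diameter (s \<inter> B) \<and> dist x ` (s \<inter> B) \<subseteq> {l..u}" if s: "s \<in> S" for s
  proof (cases "s \<inter> B = {}")
    case True
    then show ?thesis by auto
  next
    case False
    have comp: "compact (s \<inter> B)"
      using S(2)[OF s] assms(3) by (rule compact_Int_closed)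
    have cont: "continuous_on (s \<inter> B) (dist x)"
      by (intro continuous_intros)
    obtain y where y: "y \<in> s \<inter> B" "\<And>w. w \<in> s \<inter> B \<Longrightarrow> dist x y \<le> dist x w"
      using continuous_attains_inf[OF comp False cont] by blast
    obtain z where z: "z \<in> s \<inter> B" "\<And>w. w \<in> s \<inter> B \<Longrightarrow> dist x w \<le> dist x z"
      using continuous_attains_sup[OF comp False cont] by blast
    have "dist x z - dist x y \<le> dist y z"
      using dist_triangle[of x z y] by simp
    also have "\<dots> \<le> diameter (s \<inter> B)"
      using comp y z by (intro diameter_bounded_bound compact_imp_bounded)
    finally show ?thesis
      using y z by (intro exI[of _ "dist x y"] exI[of _ "dist x z"]) auto
  qed
  then obtain l u where lu: "\<And>s. s \<in> S \<Longrightarrow> l s \<le> u s" "\<And>s. s \<in> S \<Longrightarrow> u s - l s \<le> diameter (s \<inter> B)"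
    "\<And>s. s \<in> S \<Longrightarrow> dist x ` (s \<inter> B) \<subseteq> {l s..u s}"
    by metis
  obtain r where r: "a < r" "r < b" "real (card {s\<in>S. r \<in> {l s..u s}}) * (b - a) \<le> (\<Sum>s\<in>S. u s - l s)"
    using exists_rarely_covered_point[of S l u a b] S(1) lu(1) \<open>a < b\<close> by blast
  have "{s\<in>S. s \<inter> sphere x r \<noteq> {}} \<subseteq> {s\<in>S. r \<in> {l s..u s}}"
  proof safe
    fix s y assume s: "s \<in> S" and y: "y \<in> s" "y \<in> sphere x r"
    then have "y \<in> s \<inter> B"
      using assms(4) r by auto
    then show "r \<in> {l s..u s}"
      using lu(3)[OF s] y by auto
  qed
  then have "card {s\<in>S. s \<inter> sphere x r \<noteq> {}} \<le> card {s\<in>S. r \<in> {l s..u s}}"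
    using S(1) by (intro card_mono) auto
  then have "real (card {s\<in>S. s \<inter> sphere x r \<noteq> {}}) * (b - a) \<le> real (card {s\<in>S. r \<in> {l s..u s}}) * (b - a)"
    using assms(5) by (intro mult_right_mono) auto
  also have "\<dots> \<le> (\<Sum>s\<in>S. diameter (s \<inter> B))"
    using r(3) sum_mono[of S "\<lambda>s. u s - l s" "\<lambda>s. diameter (s \<inter> B)"] lu(2) by fastforce
  finally show thesis
    using that r by blast
qed

subsection \<open>The separator bound\<close>

text \<open>With \<open>2 ^ k\<close> within a factor 2 of \<open>n powr (1/d)\<close>, the last
  term dominates for \<open>d > 1\<close>, all terms are 1 for \<open>d = 1\<close>, and the series
  converges for \<open>d < 1\<close>. The summand 1 will pay for the sides of the square.\<close>

lemma geometric_sum_le_sep_bound: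
  assumes d: "0 < d"
  obtains C where "0 < C" "\<And>n. 3 \<le> n \<Longrightarrow>
    \<exists>k. (\<Sum>i\<le>k. (2 powr (d - 1)) ^ i) + real n / 2 ^ k + 1 \<le> C * sep_bound d n"
proof -
  define q :: real where "q = 2 powr (d - 1)"
  define k where "k n = nat \<lceil>log 2 (real n) / d\<rceil>" for n :: nat
  have q0: "0 < q"
    by (simp add: q_def)
  have k: "log 2 (real n) / d \<le> real (k n)" "real (k n) \<le> log 2 (real n) / d + 1"
    and lower: "real n powr (1/d) \<le> 2 ^ k n" and upper: "2 ^ k n \<le> 2 * real n powr (1/d)"
    and tail: "real n / 2 ^ k n \<le> real n powr (1 - 1/d)" if n: "3 \<le> n" for n
  proof -
    have "0 \<le> log 2 (real n) / d"
      using n d by simp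
    then show k: "log 2 (real n) / d \<le> real (k n)" "real (k n) \<le> log 2 (real n) / d + 1"
      unfolding k_def by linarith+
    have npow: "real n powr (1/d) = 2 powr (log 2 (real n) / d)"
      using n by (simp add: powr_def log_def)
    have kpow: "(2::real) ^ k n = 2 powr real (k n)"
      by (simp add: powr_realpow)
    show lower: "real n powr (1/d) \<le> 2 ^ k n"
      unfolding npow kpow using k by (intro powr_mono) auto
    have "2 powr real (k n) \<le> 2 powr (log 2 (real n) / d + 1)"
      using k by (intro powr_mono) auto
    then show "2 ^ k n \<le> 2 * real n powr (1/d)"
      unfolding npow kpow by (simp add: powr_add)
    have "real n / 2 ^ k n \<le> real n / real n powr (1/d)"
      using lower n by (intro divide_left_mono) auto
    also have "\<dots> = real n powr (1 - 1/d)"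
      using n by (simp add: powr_diff)
    finally show "real n / 2 ^ k n \<le> real n powr (1 - 1/d)" .
  qed
  consider "d > 1" | "d = 1" | "d < 1"
    by linarith
  then show thesis
  proof cases
    case 1
    then have q1: "q > 1"
      by (simp add: q_def)
    \<comment> \<open>The 2 in the constant absorbs the tail and the summand 1, both at most
      \<open>n powr (1 - 1/d)\<close>.\<close>
    have "(\<Sum>i\<le>k n. q ^ i) + real n / 2 ^ k n + 1 \<le> (q * q / (q - 1) + 2) * sep_bound d n" if n: "3 \<le> n" for n
    proof -
      define s where "s = real n powr (1 - 1/d)"
      have s1: "1 \<le> s"
        unfolding s_def using n 1 by (intro ge_one_powr_ge_zero) auto
      have "q ^ k n = (2 ^ k n) powr (d - 1)"
        by (simp add: q_def powr_powr mult.commute flip: powr_realpow)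
      also have "\<dots> \<le> (2 * real n powr (1/d)) powr (d - 1)"
        using upper[OF n] 1 by (intro powr_mono2) auto
      also have "\<dots> = q * s"
        using 1 by (simp add: powr_mult powr_powr q_def s_def diff_divide_distrib)
      finally have "q ^ k n \<le> q * s" .
      then have "q * q ^ k n \<le> q * (q * s)"
        using q0 by (intro mult_left_mono) auto
      then have "q * q ^ k n - 1 \<le> q * (q * s)"
        by simp
      then have "(q * q ^ k n - 1) / (q - 1) \<le> q * (q * s) / (q - 1)"
        using q1 by (intro divide_right_mono) auto
      moreover have "(\<Sum>i\<le>k n. q ^ i) = (q * q ^ k n - 1) / (q - 1)"
        using q1 geometric_sum[of q "Suc (k n)"] by (simp add: lessThan_Suc_atMost)
      ultimately have "(\<Sum>i\<le>k n. q ^ i) \<le> q * q / (q - 1) * s"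
        by (simp add: mult.assoc)
      then show ?thesis
        using tail[OF n] s1 1 by (simp add: sep_bound_def s_def algebra_simps)
    qed
    moreover have "0 < q * q / (q - 1) + 2"
      using q1 by (simp add: add_pos_pos)
    ultimately show thesis
      using that unfolding q_def by blast
  next
    case 2
    \<comment> \<open>The 4 collects the rounding of \<open>k\<close>, the term
      \<open>i = 0\<close>, the tail and the summand 1; since \<open>exp 1 \<le> 3\<close>, each is
      at most \<open>ln n\<close>.\<close>
    have "(\<Sum>i\<le>k n. q ^ i) + real n / 2 ^ k n + 1 \<le> (1 / ln 2 + 4) * sep_bound d n" if n: "3 \<le> n" for n
    proof -
      have "exp 1 \<le> real n"
        using n exp_le by linarith
      then have "1 \<le> ln (real n)"
        using n by (simp add: ln_ge_iff)
      moreover have "(\<Sum>i\<le>k n. q ^ i) = real (k n) + 1"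
        by (simp add: q_def 2)
      moreover have "real n / 2 ^ k n \<le> 1"
        using tail[OF n] n 2 by simp
      moreover have "real (k n) \<le> ln (real n) / ln 2 + 1"
        using k(2)[OF n] 2 by (simp add: log_def)
      ultimately have "(\<Sum>i\<le>k n. q ^ i) + real n / 2 ^ k n + 1 \<le> ln (real n) / ln 2 + 4 * ln (real n)"
        by linarith
      then show ?thesis
        using 2 by (simp add: sep_bound_def algebra_simps)
    qed
    moreover have "0 < 1 / ln 2 + (4::real)"
      by (simp add: add_pos_pos)
    ultimately show thesis
      using that unfolding q_def by blast
  next
    case 3
    then have q1: "q < 1"
      using powr_less_mono[of "d - 1" 0 2] by (simp add: q_def)
    define s where "s = 1 / (2 powr (1 - d) - (1::real))"
    have s0: "0 < s"
      using powr_less_mono[of 0 "1 - d" 2] 3 by (simp add: s_def)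
    \<comment> \<open>For fixed \<open>d\<close> the value \<open>s\<close> of
      \<open>sep_bound\<close> is a positive constant, so dividing by it expresses the uniform bound
      as a multiple of \<open>sep_bound\<close>.\<close>
    have "(\<Sum>i\<le>k n. q ^ i) + real n / 2 ^ k n + 1 \<le> (1 / (1 - q) + 2) / s * sep_bound d n" if n: "3 \<le> n" for n
    proof -
      have "(\<Sum>i\<le>k n. q ^ i) \<le> (\<Sum>i. q ^ i)"
        using q0 q1 by (intro sum_le_suminf) (auto intro: summable_geometric)
      then have "(\<Sum>i\<le>k n. q ^ i) \<le> 1 / (1 - q)"
        using suminf_geometric[of q] q0 q1 by simp
      moreover have "real n powr (1 - 1/d) \<le> real n powr 0"
        using n d 3 by (intro powr_mono) auto
      then have "real n powr (1 - 1/d) \<le> 1"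
        using n by simp
      then have "real n / 2 ^ k n \<le> 1"
        using tail[OF n] by linarith
      ultimately have "(\<Sum>i\<le>k n. q ^ i) + real n / 2 ^ k n + 1 \<le> 1 / (1 - q) + 2"
        by linarith
      moreover have "sep_bound d n = s"
        using 3 by (simp add: sep_bound_def s_def)
      ultimately show ?thesis
        using s0 by simp
    qed
    moreover have "0 < (1 / (1 - q) + 2) / s"
      using s0 q1 by (simp add: add_pos_pos)
    ultimately show thesis
      using that unfolding q_def by blast
  qed
qed

theorem theorem9:
  fixes \<delta> c :: real
  assumes "0 < \<delta>" and "\<delta> \<le> 2"
  shows "\<exists>K N0. \<forall>F P S.
           fractal_dim F = \<delta> \<and> (\<forall>Q\<in>F. finite Q \<and> net_bound \<delta> c Q) \<and>
           P \<in> F \<and> card P \<ge> N0 \<and> rsmt P S \<longrightarrow>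
           (\<exists>x r. r > 0 \<and>
              real (card (P \<inter> ball x r)) \<ge> real (card P) / 8 \<and>
              real (card (P - cball x r)) \<ge> real (card P) / 8 \<and>
              real (card {s\<in>S. s \<inter> sphere x r \<noteq> {}}) \<le> K * sep_bound \<delta> (card P))"
proof -
  obtain C where C: "0 < C" "\<And>n. 3 \<le> n \<Longrightarrow>
    \<exists>k. (\<Sum>i\<le>k. (2 powr (\<delta> - 1)) ^ i) + real n / 2 ^ k + 1 \<le> C * sep_bound \<delta> n"
    using geometric_sum_le_sep_bound[OF assms(1)] by blast
  \<comment> \<open>One factor for all three summands of the network length: the sides, the nets and
    the final round. The absolute value covers either sign of \<open>c\<close>.\<close>
  define D where "D = 8 + 8 * \<bar>c\<bar> * 2 powr \<delta>"
  have goal: "\<exists>x r. r > 0 \<and>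
              real (card (P \<inter> ball x r)) \<ge> real (card P) / 8 \<and>
              real (card (P - cball x r)) \<ge> real (card P) / 8 \<and>
              real (card {s\<in>S. s \<inter> sphere x r \<noteq> {}}) \<le> (4 * D * C) * sep_bound \<delta> (card P)"
    if P: "finite P" "net_bound \<delta> c P" and n: "9 \<le> card P" and S: "rsmt P S" for P S
  proof -
    have "8 < card P"
      using n by simp
    then obtain x R0 where R0: "0 < R0" and balanced: "\<And>r. 3/2 * R0 < r \<Longrightarrow> r < 2 * R0 \<Longrightarrow>
      real (card P) / 8 \<le> real (card (P \<inter> ball x r)) \<and> real (card P) / 8 \<le> real (card (P - cball x r))"
      using balanced_circles[OF P(1)] by blast
    define h where "h = 2 * R0"
    have h: "0 < h"
      using R0 by (simp add: h_def)
    let ?B = "cbox (x - vec h) (x + vec h)"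
    obtain k where k: "(\<Sum>i\<le>k. (2 powr (\<delta> - 1)) ^ i) + real (card P) / 2 ^ k + 1 \<le> C * sep_bound \<delta> (card P)"
      using C(2)[of "card P"] n by auto
    obtain W where W: "square_sides x h \<subseteq> W" "rect_network (P \<inter> ?B) W"
      "network_length W \<le> 8 * h + 8 * h * c * 2 powr \<delta> * (\<Sum>i\<le>k. (2 powr (\<delta> - 1)) ^ i)
         + 2 * h * (real (card P) / 2 ^ k)"
      using short_network_in_square[OF P h] by blast
    define X Y where "X = (\<Sum>i\<le>k. (2 powr (\<delta> - 1)) ^ i)" and "Y = real (card P) / 2 ^ k"
    have XY: "0 \<le> X" "0 \<le> Y"
      by (auto simp: X_def Y_def intro: sum_nonneg)
    have "8 * c * 2 powr \<delta> * X \<le> D * X"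
      unfolding D_def using XY by (intro mult_right_mono) (auto intro: order_trans[of _ "8 * \<bar>c\<bar> * 2 powr \<delta>"])
    moreover have "2 * Y \<le> D * Y" "8 \<le> D"
      unfolding D_def using XY by (auto intro!: mult_right_mono add_increasing2)
    ultimately have "8 + 8 * c * 2 powr \<delta> * X + 2 * Y \<le> D * (X + Y + 1)"
      by (simp add: algebra_simps)
    also have "\<dots> \<le> D * (C * sep_bound \<delta> (card P))"
      using k \<open>8 \<le> D\<close> by (intro mult_left_mono) (auto simp: X_def Y_def)
    finally have "h * (8 + 8 * c * 2 powr \<delta> * X + 2 * Y) \<le> h * (D * (C * sep_bound \<delta> (card P)))"
      using h by simp
    then have lenW: "network_length W \<le> h * (D * (C * sep_bound \<delta> (card P)))"
      using W(3) by (simp add: X_def Y_def algebra_simps)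
    \<comment> \<open>Any balanced radius would show that the square contains a point of
      \<open>P\<close>; \<open>7/4\<close> is the midpoint of the range.\<close>
    have "0 < card (P \<inter> ball x (7/4 * R0))"
      using balanced[of "7/4 * R0"] R0 n by simp
    then obtain p where "p \<in> P" "p \<in> ball x (7/4 * R0)"
      by (metis Int_iff card_gt_0_iff equals0I)
    then have "p \<in> P \<inter> ?B"
      using cball_subset_square[of x h] R0 by (auto simp: h_def)
    then have ne: "P \<inter> ?B \<noteq> {}"
      by blast
    have netS: "finite S" "\<And>s. s \<in> S \<Longrightarrow> compact s"
      using S rect_seg_compact by (auto simp: rsmt_def rect_network_def)
    have "3/2 * R0 < h"
      using R0 by (simp add: h_def)
    then obtain r where r: "3/2 * R0 < r" "r < h"
      "real (card {s\<in>S. s \<inter> sphere x r \<noteq> {}}) * (h - 3/2 * R0) \<le> (\<Sum>s\<in>S. diameter (s \<inter> ?B))"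
      using exists_rarely_crossed_sphere[OF netS closed_cbox cball_subset_square] by blast
    \<comment> \<open>The averaging interval has length \<open>R0 / 2\<close> while
      \<open>h = 2 * R0\<close>; their ratio is the 4 in the final constant.\<close>
    have "real (card {s\<in>S. s \<inter> sphere x r \<noteq> {}}) * (R0 / 2) \<le> h * (D * (C * sep_bound \<delta> (card P)))"
      using r(3) rsmt_length_in_square[OF S h ne W(1,2)] lenW by (simp add: h_def)
    then have "real (card {s\<in>S. s \<inter> sphere x r \<noteq> {}}) * (R0 / 2) \<le> (4 * D * C) * sep_bound \<delta> (card P) * (R0 / 2)"
      by (simp add: h_def mult_ac)
    then have "real (card {s\<in>S. s \<inter> sphere x r \<noteq> {}}) \<le> (4 * D * C) * sep_bound \<delta> (card P)"
      using R0 by (subst (asm) mult_le_cancel_right_pos) auto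
    moreover have "0 < r" "r < 2 * R0"
      using r R0 by (auto simp: h_def)
    ultimately show ?thesis
      using balanced[OF r(1)] by blast
  qed
  show ?thesis
  \<comment> \<open>The threshold 9 provides the more than eight points required by
    \<open>balanced_circles\<close>.\<close>
  proof (rule exI[of _ "4 * D * C"], rule exI[of _ 9], intro allI impI, elim conjE)
    fix F P S
    assume "\<forall>Q\<in>F. finite Q \<and> net_bound \<delta> c Q" "P \<in> F" "9 \<le> card P" "rsmt P S"
    then show "\<exists>x r. r > 0 \<and>
              real (card (P \<inter> ball x r)) \<ge> real (card P) / 8 \<and>
              real (card (P - cball x r)) \<ge> real (card P) / 8 \<and>
              real (card {s\<in>S. s \<inter> sphere x r \<noteq> {}}) \<le> (4 * D * C) * sep_bound \<delta> (card P)"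
      using goal by blast
  qed
qed

end
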